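(* Let $\mathcal M=\langle W,R,\{\mathcal M_w\}_{w\in W}\rangle$ be a concrete mixed model and, for each $w\in W$, let $T_w:=\{\varphi\in\mathsf{Form}_\Box\mid \overline w\Vdash\varphi\}$. Then the triple $\langle W,R,\{T_w\}_{w\in W}\rangle$ is a mixed model in $\mathcal{MM}(\mathsf{CPC},\mathsf{IPC})$.
   Context: The modal language $\mathsf{Form}_\Box$ is generated by $\top$, $\bot$, propositional variables $p\in\mathsf{Prop}$, and $(\varphi\wedge\psi)$, $(\varphi\vee\psi)$, $(\varphi\to\psi)$, $\Box\varphi$; $\neg\varphi$ abbreviates $\varphi\to\bot$. $\mathsf{IPC}$ (over the modal language) is the Hilbert system whose axioms are all instances, with $A,B,C$ arbitrary formulas of $\mathsf{Form}_\Box$, of the schemes $A\to(B\to A)$; $(A\to B)\to((A\to(B\to C))\to(A\to C))$; $A\to(A\vee B)$; $B\to(A\vee B)$; $(A\vee B)\to((A\to C)\to((B\to C)\to C))$; $A\to(B\to(A\wedge B))$; $(A\wedge B)\to A$; $(A\wedge B)\to B$; $\bot\to A$; its only rule is modus ponens. $\mathsf{CPC}$ adds the scheme $\neg A\vee A$. For a logic $L$ and $\Gamma\subseteq\mathsf{Form}_\Box$, $\Gamma\vdash_L\varphi$ means there is a finite sequence ending in $\varphi$ each member of which is an axiom of $L$, a member of $\Gamma$, or obtained by modus ponens from earlier members. An intuitionistic Kripke model is $\langle U,\leq,V\rangle$ with $U\ne\emptyset$, $\leq$ a partial order, $V:U\to\mathcal P(\mathsf{Prop})$ monotone in $\leq$;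 rooted if it has a least element. A concrete mixed model is $\langle W,R,\{\mathcal M_w\}_{w\in W}\rangle$ with $W\ne\emptyset$, $R\subseteq W\times W$, each $\mathcal M_w=\langle W_w,\leq_w,V_w\rangle$ a rooted intuitionistic Kripke model with root $\overline w$, the $W_w$ pairwise disjoint; $\leq$, $V$ denote the unions of the $\leq_w$, $V_w$. Forcing at a point $x\in\bigcup_w W_w$: $x\Vdash p$ iff $p\in V(x)$; $x\nVdash\bot$; $\wedge,\vee$ pointwise; $x\Vdash\varphi\to\psi$ iff for all $y\geq x$, $y\Vdash\varphi$ implies $y\Vdash\psi$; $x\Vdash\Box\varphi$ iff $\overline v\Vdash\varphi$ for all $v\in W$ with $wRv$, where $w$ is the unique element of $W$ with $\overline w\leq x$. The class $\mathcal{MM}(\mathsf{CPC},\mathsf{IPC})$ consists of triples $\langle W,R,\{T_w\}_{w\in W}\rangle$ with $W$ a nonempty set, $R\subseteq W\times W$, each $T_w\subseteq\mathsf{Form}_\Box$, such that for each $w\in W$ there is a logic $L_w\in\{\mathsf{CPC},\mathsf{IPC}\}$ with: (1) $\bot\notin T_w$; (2) $T_w\vdash_{L_w}\varphi$ implies $\varphi\in T_w$; (3) $\Box\varphi\in T_w$ iff for all $v\in W$ with $wRv$, $\varphi\in T_v$; (4) $\neg\Box\varphi\in T_w$ iff there is $v\in W$ with $wRv$ and $\varphi\notin T_v$ (for all $\varphi\in\mathsf{Form}_\Box$). *)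

theory Defs
  imports Main "HOL-Library.Disjoint_Sets"
begin

datatype 'p fm =
    Top
  | Bot
  | Var 'p
  | Conj "'p fm" "'p fm"
  | Disj "'p fm" "'p fm"
  | Imp "'p fm" "'p fm"
  | Box "'p fm"

abbreviation Neg :: "'p fm \<Rightarrow> 'p fm" where
  "Neg A \<equiv> Imp A Bot"

(* A logic is represented by its set of axioms; modus ponens is the only rule. *)

inductive_set IPC :: "'p fm set" where
  "Imp A (Imp B A) \<in> IPC"
| "Imp (Imp A B) (Imp (Imp A (Imp B C)) (Imp A C)) \<in> IPC"
| "Imp A (Disj A B) \<in> IPC"
| "Imp B (Disj A B) \<in> IPC"
| "Imp (Disj A B) (Imp (Imp A C) (Imp (Imp B C) C)) \<in> IPC"
| "Imp A (Imp B (Conj A B)) \<in> IPC"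
| "Imp (Conj A B) A \<in> IPC"
| "Imp (Conj A B) B \<in> IPC"
| "Imp Bot A \<in> IPC"

definition CPC :: "'p fm set" where
  "CPC = IPC \<union> {Disj (Neg A) A | A. True}"

definition derives :: "'p fm set \<Rightarrow> 'p fm set \<Rightarrow> 'p fm \<Rightarrow> bool" where
  "derives L \<Gamma> \<phi> \<longleftrightarrow>
     (\<exists>s. s \<noteq> [] \<and> last s = \<phi> \<and>
       (\<forall>i < length s. s ! i \<in> L \<or> s ! i \<in> \<Gamma> \<or>
          (\<exists>j < i. \<exists>k < i. s ! k = Imp (s ! j) (s ! i))))"

record ('u, 'p) int_model =
  points :: "'u set"
  order :: "('u \<times> 'u) set"
  val :: "'u \<Rightarrow> 'p set"

definition int_kripke_model :: "('u, 'p) int_model \<Rightarrow> bool" where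
  "int_kripke_model M \<longleftrightarrow>
     points M \<noteq> {} \<and>
     partial_order_on (points M) (order M) \<and>
     (\<forall>x y. (x, y) \<in> order M \<longrightarrow> val M x \<subseteq> val M y)"

definition is_least :: "('u, 'p) int_model \<Rightarrow> 'u \<Rightarrow> bool" where
  "is_least M r \<longleftrightarrow> r \<in> points M \<and> (\<forall>x \<in> points M. (r, x) \<in> order M)"

definition rooted :: "('u, 'p) int_model \<Rightarrow> bool" where
  "rooted M \<longleftrightarrow> (\<exists>r. is_least M r)"

definition base_point :: "('u, 'p) int_model \<Rightarrow> 'u" where
  "base_point M = (THE r. is_least M r)"

(* A family indexed by W is a total function whose values outside W are irrelevant. *)

definition concrete_mixed_model ::
  "'w set \<Rightarrow> ('w \<times> 'w) set \<Rightarrow> ('w \<Rightarrow> ('u, 'p) int_model) \<Rightarrow> bool" where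
  "concrete_mixed_model W R M \<longleftrightarrow>
     W \<noteq> {} \<and> R \<subseteq> W \<times> W \<and>
     (\<forall>w \<in> W. int_kripke_model (M w) \<and> rooted (M w)) \<and>
     disjoint_family_on (\<lambda>w. points (M w)) W"

definition union_order :: "'w set \<Rightarrow> ('w \<Rightarrow> ('u, 'p) int_model) \<Rightarrow> ('u \<times> 'u) set" where
  "union_order W M = (\<Union>w \<in> W. order (M w))"

definition union_val :: "'w set \<Rightarrow> ('w \<Rightarrow> ('u, 'p) int_model) \<Rightarrow> 'u \<Rightarrow> 'p set" where
  "union_val W M x = (\<Union>w \<in> {w \<in> W. x \<in> points (M w)}. val (M w) x)"

definition world_of :: "'w set \<Rightarrow> ('w \<Rightarrow> ('u, 'p) int_model) \<Rightarrow> 'u \<Rightarrow> 'w" where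
  "world_of W M x = (THE w. w \<in> W \<and> (base_point (M w), x) \<in> union_order W M)"

primrec forces ::
  "'w set \<Rightarrow> ('w \<times> 'w) set \<Rightarrow> ('w \<Rightarrow> ('u, 'p) int_model) \<Rightarrow> 'u \<Rightarrow> 'p fm \<Rightarrow> bool" where
  "forces W R M x Top \<longleftrightarrow> True"
| "forces W R M x Bot \<longleftrightarrow> False"
| "forces W R M x (Var p) \<longleftrightarrow> p \<in> union_val W M x"
| "forces W R M x (Conj A B) \<longleftrightarrow> forces W R M x A \<and> forces W R M x B"
| "forces W R M x (Disj A B) \<longleftrightarrow> forces W R M x A \<or> forces W R M x B"
| "forces W R M x (Imp A B) \<longleftrightarrow>
     (\<forall>y. (x, y) \<in> union_order W M \<longrightarrow> forces W R M y A \<longrightarrow> forces W R M y B)"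
| "forces W R M x (Box A) \<longleftrightarrow>
     (\<forall>v \<in> W. (world_of W M x, v) \<in> R \<longrightarrow> forces W R M (base_point (M v)) A)"

definition MM :: "'p fm set set \<Rightarrow> ('w set \<times> ('w \<times> 'w) set \<times> ('w \<Rightarrow> 'p fm set)) set" where
  "MM \<L> = {(W, R, T). W \<noteq> {} \<and> R \<subseteq> W \<times> W \<and>
     (\<forall>w \<in> W. \<exists>L \<in> \<L>.
        Bot \<notin> T w \<and>
        (\<forall>\<phi>. derives L (T w) \<phi> \<longrightarrow> \<phi> \<in> T w) \<and>
        (\<forall>\<phi>. Box \<phi> \<in> T w \<longleftrightarrow> (\<forall>v \<in> W. (w, v) \<in> R \<longrightarrow> \<phi> \<in> T v)) \<and>
        (\<forall>\<phi>. Neg (Box \<phi>) \<in> T w \<longleftrightarrow> (\<exists>v \<in> W. (w, v) \<in> R \<and> \<phi> \<notin> T v)))}"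

lemma base_point_least:
  assumes "int_kripke_model M" "rooted M"
  shows "is_least M (base_point M)"
proof -
  obtain r where r: "is_least M r"
    using assms(2) by (auto simp: rooted_def)
  have "s = r" if "is_least M s" for s
    using that r assms(1)
    by (auto simp: is_least_def int_kripke_model_def partial_order_on_def dest: antisymD)
  with r show ?thesis
    unfolding base_point_def by (rule theI)
qed

lemma world_of_eq:
  assumes mm: "concrete_mixed_model W R M" and w: "w \<in> W" and x: "x \<in> points (M w)"
  shows "world_of W M x = w"
  unfolding world_of_def
proof (rule the_equality)
  have "is_least (M w) (base_point (M w))"
    using mm w by (auto simp: concrete_mixed_model_def intro: base_point_least)
  then show "w \<in> W \<and> (base_point (M w), x) \<in> union_order W M"
    using w x by (auto simp: is_least_def union_order_def)
next
  fix v assume v: "v \<in> W \<and> (base_point (M v), x) \<in> union_order W M"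
  then obtain u where u: "u \<in> W" "(base_point (M v), x) \<in> order (M u)"
    by (auto simp: union_order_def)
  have "order (M u) \<subseteq> points (M u) \<times> points (M u)"
    using mm u(1) by (auto simp: concrete_mixed_model_def int_kripke_model_def
        partial_order_on_def preorder_on_def)
  with u have bu: "base_point (M v) \<in> points (M u)" and xu: "x \<in> points (M u)"
    by auto
  have "is_least (M v) (base_point (M v))"
    using mm v by (auto simp: concrete_mixed_model_def intro: base_point_least)
  then have bv: "base_point (M v) \<in> points (M v)"
    by (simp add: is_least_def)
  have disj: "a = b" if "a \<in> W" "b \<in> W" "z \<in> points (M a)" "z \<in> points (M b)" for a b z
    using mm that unfolding concrete_mixed_model_def disjoint_family_on_def by blast
  show "v = w"
    using disj[OF _ u(1) bv bu] disj[OF u(1) w xu x] v by simp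
qed

end

theory Submission
  imports Defs
begin

text \<open>The logic \<open>IPC\<close> serves at every world: forcing is persistent along the union order, so the
  formulas forced at a root are closed under intuitionistic derivation. The truth value of a boxed
  formula is constant on each component, so at a root the negation of \<open>Box \<phi>\<close> is forced exactly
  when \<open>Box \<phi>\<close> is not.\<close>

lemma order_points:
  assumes "concrete_mixed_model W R M" "w \<in> W" "(x, y) \<in> order (M w)"
  shows "x \<in> points (M w)" "y \<in> points (M w)"
proof -
  have "order (M w) \<subseteq> points (M w) \<times> points (M w)"
    using assms(1,2) by (auto simp: concrete_mixed_model_def int_kripke_model_def
        partial_order_on_def preorder_on_def)
  then show "x \<in> points (M w)" "y \<in> points (M w)"
    using assms(3) by auto
qed

text \<open>Both worlds equal \<open>world_of W M x\<close>.\<close>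

lemma component_unique:
  assumes "concrete_mixed_model W R M" "w \<in> W" "v \<in> W" "x \<in> points (M w)" "x \<in> points (M v)"
  shows "w = v"
  using world_of_eq[OF assms(1,2,4)] world_of_eq[OF assms(1,3,5)] by simp

text \<open>By disjointness of the components, a pair starting in one of them can only come from the
  order of that component. Moving up from a point therefore never leaves its component.\<close>

lemma union_order_iff:
  assumes "concrete_mixed_model W R M" "w \<in> W" "x \<in> points (M w)"
  shows "(x, y) \<in> union_order W M \<longleftrightarrow> (x, y) \<in> order (M w)"
  using assms order_points(1)[OF assms(1)] component_unique[OF assms(1)]
  unfolding union_order_def by blast

lemma union_val_eq:
  assumes "concrete_mixed_model W R M" "w \<in> W" "x \<in> points (M w)"
  shows "union_val W M x = val (M w) x"
  using assms component_unique[OF assms(1)] unfolding union_val_def by blast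

lemma union_order_refl:
  assumes "concrete_mixed_model W R M" "w \<in> W" "x \<in> points (M w)"
  shows "(x, x) \<in> union_order W M"
proof -
  have "refl_on (points (M w)) (order (M w))"
    using assms by (simp add: concrete_mixed_model_def int_kripke_model_def
        partial_order_on_def preorder_on_def)
  then show ?thesis
    using assms by (simp add: union_order_iff refl_onD)
qed

text \<open>The two pairs could a priori come from different components; the shared middle point
  \<open>y\<close> rules this out.\<close>

lemma union_order_trans:
  assumes mm: "concrete_mixed_model W R M"
    and "(x, y) \<in> union_order W M" "(y, z) \<in> union_order W M"
  shows "(x, z) \<in> union_order W M"
proof -
  obtain w where w: "w \<in> W" "(x, y) \<in> order (M w)"
    using assms(2) by (auto simp: union_order_def)
  have "trans (order (M w))"
    using mm w(1) by (simp add: concrete_mixed_model_def int_kripke_model_def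
        partial_order_on_def preorder_on_def)
  moreover have "(y, z) \<in> order (M w)"
    using assms(3) union_order_iff[OF mm w(1) order_points(2)[OF mm w]] by simp
  ultimately have "(x, z) \<in> order (M w)"
    using w(2) by (blast dest: transD)
  then show ?thesis
    using w(1) by (auto simp: union_order_def)
qed

lemma union_order_world:
  assumes mm: "concrete_mixed_model W R M" and "(x, y) \<in> union_order W M"
  obtains w where "w \<in> W" "(x, y) \<in> order (M w)" "x \<in> points (M w)" "y \<in> points (M w)"
  using assms order_points[OF mm] by (auto simp: union_order_def)

text \<open>Persistence: variables persist by monotonicity of \<open>val\<close>, implications by
  transitivity, and boxed formulas because their forcing depends only on \<open>world_of\<close>,
  which agrees at \<open>x\<close> and \<open>y\<close>.\<close>

lemma forces_mono:
  assumes mm: "concrete_mixed_model W R M"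
    and xy: "(x, y) \<in> union_order W M" and "forces W R M x A"
  shows "forces W R M y A"
proof -
  obtain w where w: "w \<in> W" "(x, y) \<in> order (M w)" "x \<in> points (M w)" "y \<in> points (M w)"
    using union_order_world[OF mm xy] .
  have "val (M w) x \<subseteq> val (M w) y"
    using mm w(1,2) by (simp add: concrete_mixed_model_def int_kripke_model_def)
  then have "union_val W M x \<subseteq> union_val W M y"
    using union_val_eq[OF mm w(1,3)] union_val_eq[OF mm w(1,4)] by simp
  moreover have "world_of W M x = world_of W M y"
    using world_of_eq[OF mm w(1,3)] world_of_eq[OF mm w(1,4)] by simp
  ultimately show ?thesis
    using \<open>forces W R M x A\<close> union_order_trans[OF mm xy] by (induction A) auto
qed

text \<open>The point \<open>x\<close> may be arbitrary: every axiom is an implication, so at a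
  point outside all components, which has no successors, it holds vacuously.\<close>

lemma forces_IPC:
  assumes mm: "concrete_mixed_model W R M" and "A \<in> IPC"
  shows "forces W R M x A"
proof -
  \<comment> \<open>Reflexivity holds only at points of components, and every successor is such a
    point.\<close>
  have refl: "(y, y) \<in> union_order W M" if "(z, y) \<in> union_order W M" for y z
    using union_order_world[OF mm that] union_order_refl[OF mm] by metis
  note trans = union_order_trans[OF mm] and mono = forces_mono[OF mm]
  show ?thesis
    using \<open>A \<in> IPC\<close>
  proof cases
    case (1 A B) then show ?thesis by (auto intro: mono)
  next
    \<comment> \<open>\<open>trans\<close> brings both implications to the final point forcing
      \<open>A\<close>; \<open>refl\<close> then applies \<open>Imp B C\<close> at that point
      itself.\<close>
    case (2 A B C) then show ?thesis by simp (meson refl trans)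
  next
    case (5 A B C) then show ?thesis by simp (meson refl trans mono)
  next
    case (6 A B) then show ?thesis by (auto intro: mono)
  qed auto
qed

text \<open>Premises of modus ponens stand at earlier positions, so strong induction on the position
  puts every member of the sequence in \<open>S\<close>.\<close>

lemma derives_closed:
  assumes "derives L \<Gamma> \<phi>" "L \<subseteq> S" "\<Gamma> \<subseteq> S"
    and mp: "\<And>A B. A \<in> S \<Longrightarrow> Imp A B \<in> S \<Longrightarrow> B \<in> S"
  shows "\<phi> \<in> S"
proof -
  obtain s where s: "s \<noteq> []" "last s = \<phi>"
    and step: "\<And>i. i < length s \<Longrightarrow> s ! i \<in> L \<or> s ! i \<in> \<Gamma> \<or>
          (\<exists>j < i. \<exists>k < i. s ! k = Imp (s ! j) (s ! i))"
    using assms(1) unfolding derives_def by blast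
  have "s ! i \<in> S" if "i < length s" for i
    using that
  proof (induction i rule: less_induct)
    case (less i)
    have IH: "s ! j \<in> S" if "j < i" for j
      using less that by simp
    from step[OF less.prems] show ?case
      using assms(2,3) IH mp by (metis subsetD)
  qed
  then show ?thesis
    using s by (metis last_conv_nth diff_less length_greater_0_conv zero_less_one)
qed

theorem theorem2p2p4:
  fixes W :: "'w set" and R :: "('w \<times> 'w) set"
    and M :: "'w \<Rightarrow> ('u, 'p) int_model"
    and T :: "'w \<Rightarrow> 'p fm set"
  assumes "concrete_mixed_model W R M"
    and "\<And>w. w \<in> W \<Longrightarrow> T w = {\<phi>. forces W R M (base_point (M w)) \<phi>}"
  shows "(W, R, T) \<in> MM {CPC, IPC}"
proof -
  note mm = assms(1) and T = assms(2)
  have "Bot \<notin> T w \<and>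
        (\<forall>\<phi>. derives IPC (T w) \<phi> \<longrightarrow> \<phi> \<in> T w) \<and>
        (\<forall>\<phi>. Box \<phi> \<in> T w \<longleftrightarrow> (\<forall>v \<in> W. (w, v) \<in> R \<longrightarrow> \<phi> \<in> T v)) \<and>
        (\<forall>\<phi>. Neg (Box \<phi>) \<in> T w \<longleftrightarrow> (\<exists>v \<in> W. (w, v) \<in> R \<and> \<phi> \<notin> T v))"
    if w: "w \<in> W" for w
  proof (intro conjI allI impI)
    let ?r = "base_point (M w)"
    have root: "?r \<in> points (M w)"
      using base_point_least[of "M w"] mm w
      by (simp add: concrete_mixed_model_def is_least_def)
    note refl = union_order_refl[OF mm w root]
    show "Bot \<notin> T w"
      using T[OF w] by simp
    show "\<phi> \<in> T w" if "derives IPC (T w) \<phi>" for \<phi>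
      using that
    proof (rule derives_closed)
      show "IPC \<subseteq> T w"
        using T[OF w] forces_IPC[OF mm] by auto
      \<comment> \<open>The forced implication is instantiated at the root itself.\<close>
      show "B \<in> T w" if "A \<in> T w" "Imp A B \<in> T w" for A B
        using that T[OF w] refl by auto
    qed simp
    \<comment> \<open>Stated for every \<open>x\<close> of the component, since negation at the root
      quantifies over all points above it; the right-hand side does not mention
      \<open>x\<close>.\<close>
    have box: "forces W R M x (Box \<phi>) \<longleftrightarrow> (\<forall>v \<in> W. (w, v) \<in> R \<longrightarrow> \<phi> \<in> T v)"
      if "x \<in> points (M w)" for x \<phi>
      using world_of_eq[OF mm w that] T by simp
    show "Box \<phi> \<in> T w \<longleftrightarrow> (\<forall>v \<in> W. (w, v) \<in> R \<longrightarrow> \<phi> \<in> T v)" for \<phi>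
      using box[OF root] T[OF w] by simp
    have "y \<in> points (M w)" if "(?r, y) \<in> union_order W M" for y
      using that union_order_iff[OF mm w root] order_points(2)[OF mm w] by simp
    \<comment> \<open>If the box fails at the root, it fails at every point above it; conversely,
      the root lies above itself.\<close>
    then have "forces W R M ?r (Neg (Box \<phi>)) \<longleftrightarrow> \<not> forces W R M ?r (Box \<phi>)" for \<phi>
      using refl box root by (metis forces.simps(2,6))
    then show "Neg (Box \<phi>) \<in> T w \<longleftrightarrow> (\<exists>v \<in> W. (w, v) \<in> R \<and> \<phi> \<notin> T v)" for \<phi>
      \<comment> \<open>Without \<open>forces.simps\<close> the negated box stays folded, so the
        preceding equivalence can rewrite it.\<close>
      using box[OF root] T[OF w] by (simp del: forces.simps)
  qed
  then show ?thesis
    using mm unfolding MM_def by (auto simp: concrete_mixed_model_def)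
qed

end
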